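(* Let $n\ge3$, $\varepsilon\in\{-1,1\}$, and let $(\mathfrak{r}_{2n+1}(2-n,\varepsilon),\cdot,[-,-])$ be a non-trivial transposed Poisson algebra structure on the Lie algebra $\mathfrak{r}_{2n+1}(2-n,\varepsilon)$. Then, up to isomorphism, the multiplication $\cdot$ has one of the following forms, where products of basis elements that are not listed (up to commutativity) are zero: $\mathbf{TP}_1$: $x\cdot x=e_{2n}$; $\mathbf{TP}_2$: $e_2\cdot x=e_{2n}$, $x\cdot x=(3-2n)e_{2n-1}$.
   Context: All algebras are over $\mathbb{C}$. A transposed Poisson algebra is a vector space $\mathfrak{L}$ with bilinear operations $\cdot$ and $[-,-]$ such that $(\mathfrak{L},\cdot)$ is a commutative associative algebra, $(\mathfrak{L},[-,-])$ is a Lie algebra, and $2z\cdot[u,v]=[z\cdot u,v]+[u,z\cdot v]$ for all $u,v,z\in\mathfrak{L}$. A transposed Poisson structure on a Lie algebra $(\mathfrak{L},[-,-])$ is an operation $\cdot$ making $(\mathfrak{L},\cdot,[-,-])$ a transposed Poisson algebra; it is trivial if $u\cdot v=0$ for all $u,v$. An isomorphism of transposed Poisson algebras is a linear bijection preserving both operations (so two structures on the same Lie algebra are isomorphic iff some Lie algebra automorphism carries one product to the other). $\mathfrak{r}_{2n+1}(2-n,\varepsilon)$ is the $(2n+1)$-dimensional Lie algebra with basis $e_1,\dots,e_{2n},x$ and brackets $[e_i,e_1]=e_{i+1}$ for $2\le i\le 2n-2$; $[e_i,e_{2n+1-i}]=(-1)^ie_{2n}$ for $2\le i\le n$; $[e_1,x]=e_1+\varepsilon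 e_{2n}$; $[e_i,x]=(i-n)e_i$ for $2\le i\le 2n-1$; $[e_{2n},x]=e_{2n}$; brackets of basis elements not determined by these and antisymmetry are zero. *)

theory Defs
  imports Complex_Main
begin

text \<open>
  Algebras live on a whole type carrying the structure of a complex vector space given by
  a scalar multiplication \<open>scale\<close>. An operation is bilinear if it is linear, in the sense of
  \<open>Vector_Spaces\<close>, in each argument.
\<close>

locale bilinear_operation = vector_space scale
  for scale :: "complex \<Rightarrow> 'a::ab_group_add \<Rightarrow> 'a" +
  fixes f :: "'a \<Rightarrow> 'a \<Rightarrow> 'a"
  assumes linear_right: "\<And>u. Vector_Spaces.linear scale scale (\<lambda>v. f u v)"
    and linear_left: "\<And>v. Vector_Spaces.linear scale scale (\<lambda>u. f u v)"

locale lie_algebra = bilinear_operation scale bracket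
  for scale :: "complex \<Rightarrow> 'a::ab_group_add \<Rightarrow> 'a"
    and bracket :: "'a \<Rightarrow> 'a \<Rightarrow> 'a" +
  assumes bracket_self: "\<And>u. bracket u u = 0"
    and jacobi: "\<And>u v w. bracket u (bracket v w) + bracket v (bracket w u)
                          + bracket w (bracket u v) = 0"

locale comm_assoc_algebra = bilinear_operation scale mult
  for scale :: "complex \<Rightarrow> 'a::ab_group_add \<Rightarrow> 'a"
    and mult :: "'a \<Rightarrow> 'a \<Rightarrow> 'a" +
  assumes mult_commute: "\<And>u v. mult u v = mult v u"
    and mult_assoc: "\<And>u v w. mult (mult u v) w = mult u (mult v w)"

locale transposed_poisson_algebra =
  lie: lie_algebra scale bracket + prod: comm_assoc_algebra scale mult
  for scale :: "complex \<Rightarrow> 'a::ab_group_add \<Rightarrow> 'a"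
    and bracket mult :: "'a \<Rightarrow> 'a \<Rightarrow> 'a" +
  assumes transposed_leibniz:
    "\<And>u v z. scale 2 (mult z (bracket u v)) = bracket (mult z u) v + bracket u (mult z v)"

locale transposed_poisson_isomorphism =
  dom: transposed_poisson_algebra scale bracket mult +
  cod: transposed_poisson_algebra scale' bracket' mult' +
  Vector_Spaces.linear scale scale' \<phi>
  for scale :: "complex \<Rightarrow> 'a::ab_group_add \<Rightarrow> 'a"
    and bracket mult :: "'a \<Rightarrow> 'a \<Rightarrow> 'a"
    and scale' :: "complex \<Rightarrow> 'b::ab_group_add \<Rightarrow> 'b"
    and bracket' mult' :: "'b \<Rightarrow> 'b \<Rightarrow> 'b"
    and \<phi> :: "'a \<Rightarrow> 'b" +
  assumes bij: "bij \<phi>"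
    and map_bracket: "\<And>u v. \<phi> (bracket u v) = bracket' (\<phi> u) (\<phi> v)"
    and map_mult: "\<And>u v. \<phi> (mult u v) = mult' (\<phi> u) (\<phi> v)"

text \<open>
  The Lie algebra \<open>\<rr>\<^sub>2\<^sub>n\<^sub>+\<^sub>1(2 - n, \<epsilon>)\<close>, given by a basis \<open>e 1, \<dots>, e (2 * n), x\<close> and its brackets.
  Values of \<open>e\<close> outside \<open>{1..2 * n}\<close> are irrelevant. All brackets of an \<open>e i\<close> with \<open>x\<close> are
  prescribed, so by antisymmetry the vanishing ones that remain are of the form
  \<open>[e i, e j]\<close> with \<open>i < j\<close>.
\<close>

locale lie_algebra_r = lie_algebra scale bracket
  for scale :: "complex \<Rightarrow> 'a::ab_group_add \<Rightarrow> 'a"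
    and bracket :: "'a \<Rightarrow> 'a \<Rightarrow> 'a" +
  fixes n :: nat and \<epsilon> :: complex and e :: "nat \<Rightarrow> 'a" and x :: 'a
  assumes basis_distinct: "inj_on e {1..2 * n}" "x \<notin> e ` {1..2 * n}"
    and basis_independent: "independent (insert x (e ` {1..2 * n}))"
    and basis_span: "span (insert x (e ` {1..2 * n})) = UNIV"
    and bracket_e_e1: "\<And>i. 2 \<le> i \<Longrightarrow> i \<le> 2 * n - 2 \<Longrightarrow> bracket (e i) (e 1) = e (i + 1)"
    and bracket_e_opposite: "\<And>i. 2 \<le> i \<Longrightarrow> i \<le> n \<Longrightarrow>
          bracket (e i) (e (2 * n + 1 - i)) = scale ((- 1) ^ i) (e (2 * n))"
    and bracket_e1_x: "bracket (e 1) x = e 1 + scale \<epsilon> (e (2 * n))"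
    and bracket_e_x: "\<And>i. 2 \<le> i \<Longrightarrow> i \<le> 2 * n - 1 \<Longrightarrow>
          bracket (e i) x = scale (of_nat i - of_nat n) (e i)"
    and bracket_e2n_x: "bracket (e (2 * n)) x = e (2 * n)"
    and bracket_e_e_zero: "\<And>i j. 1 \<le> i \<Longrightarrow> i < j \<Longrightarrow> j \<le> 2 * n \<Longrightarrow>
          \<not> (i = 1 \<and> 2 \<le> j \<and> j \<le> 2 * n - 2) \<Longrightarrow>
          \<not> (2 \<le> i \<and> i \<le> n \<and> j = 2 * n + 1 - i) \<Longrightarrow>
          bracket (e i) (e j) = 0"

text \<open>
  Multiplication tables on the basis; \<open>mult\<close> is meant to be commutative and bilinear.
\<close>

definition TP1 :: "nat \<Rightarrow> (nat \<Rightarrow> 'a::ab_group_add) \<Rightarrow> 'a \<Rightarrow> ('a \<Rightarrow> 'a \<Rightarrow> 'a) \<Rightarrow> bool"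
  where "TP1 n e x mult \<longleftrightarrow>
    mult x x = e (2 * n) \<and>
    (\<forall>i\<in>{1..2 * n}. mult (e i) x = 0) \<and>
    (\<forall>i\<in>{1..2 * n}. \<forall>j\<in>{1..2 * n}. mult (e i) (e j) = 0)"

definition TP2 ::
  "(complex \<Rightarrow> 'a::ab_group_add \<Rightarrow> 'a) \<Rightarrow> nat \<Rightarrow> (nat \<Rightarrow> 'a) \<Rightarrow> 'a \<Rightarrow> ('a \<Rightarrow> 'a \<Rightarrow> 'a) \<Rightarrow> bool"
  where "TP2 scale n e x mult \<longleftrightarrow>
    mult (e 2) x = e (2 * n) \<and>
    mult x x = scale (3 - 2 * of_nat n) (e (2 * n - 1)) \<and>
    (\<forall>i\<in>{1..2 * n} - {2}. mult (e i) x = 0) \<and>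
    (\<forall>i\<in>{1..2 * n}. \<forall>j\<in>{1..2 * n}. mult (e i) (e j) = 0)"

end

theory Submission
  imports Defs
begin

text \<open>
  In a transposed Poisson algebra every multiplication operator \<open>f\<close> is a half-derivation:
  \<open>2 f[u, v] = [f u, v] + [u, f v]\<close>. On \<open>\<rr>\<^sub>2\<^sub>n\<^sub>+\<^sub>1(2 - n, \<epsilon>)\<close> the half-derivations are the maps
  \<open>l \<cdot> id + g\<close> where \<open>g\<close> kills all basis vectors except \<open>g x = (3 - 2n) \<beta> e\<^sub>2\<^sub>n\<^sub>-\<^sub>1 + \<gamma> e\<^sub>2\<^sub>n\<close> and
  \<open>g e\<^sub>2 = \<beta> e\<^sub>2\<^sub>n\<close>. Commutativity forces \<open>l = 0\<close> and leaves the two-parameter family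
  \<open>x \<cdot> x = (3 - 2n) \<beta> e\<^sub>2\<^sub>n\<^sub>-\<^sub>1 + \<gamma> e\<^sub>2\<^sub>n\<close>, \<open>e\<^sub>2 \<cdot> x = \<beta> e\<^sub>2\<^sub>n\<close>. The automorphism \<open>exp (s ad e\<^sub>2) = 1 + s ad e\<^sub>2\<close>
  removes \<open>\<gamma>\<close> when \<open>\<beta> \<noteq> 0\<close>, and a diagonal automorphism with \<open>e\<^sub>1 \<mapsto> a e\<^sub>1\<close>, \<open>e\<^sub>2 \<mapsto> t e\<^sub>2\<close>, \<open>x \<mapsto> x\<close>,
  which exists iff \<open>t\<^sup>2 a\<^sup>2\<^sup>n\<^sup>-\<^sup>4 = 1\<close>, rescales the remaining parameter to \<open>1\<close>.
\<close>

section \<open>Bilinearity rules and transport of structure\<close>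

context bilinear_operation
begin

lemma add_left: "f (u + v) w = f u w + f v w"
  using linear_left[of w] unfolding Vector_Spaces.linear_def module_hom_def module_hom_axioms_def by blast

lemma add_right: "f w (u + v) = f w u + f w v"
  using linear_right[of w] unfolding Vector_Spaces.linear_def module_hom_def module_hom_axioms_def by blast

lemma scale_left_arg: "f (scale a u) w = scale a (f u w)"
  using linear_left[of w] unfolding Vector_Spaces.linear_def module_hom_def module_hom_axioms_def by blast

lemma scale_right_arg: "f w (scale a u) = scale a (f w u)"
  using linear_right[of w] unfolding Vector_Spaces.linear_def module_hom_def module_hom_axioms_def by blast

lemma zero_left: "f 0 w = 0"
  using add_left[of 0 0 w] by simp

lemma zero_right: "f w 0 = 0"
  using add_right[of w 0 0] by simp

lemmas bilinear_simps = add_left add_right scale_left_arg scale_right_arg zero_left zero_right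

end

lemma (in lie_algebra) bracket_antisym: "bracket u v = - bracket v u"
proof -
  have "bracket (u + v) (u + v) = bracket u v + bracket v u"
    unfolding add_left add_right by (simp add: bracket_self)
  then have "bracket u v + bracket v u = 0"
    by (simp only: bracket_self)
  then show ?thesis by (simp add: eq_neg_iff_add_eq_0)
qed

text \<open>Since \<open>\<phi>\<close> is onto, every law for \<open>mult'\<close> is the law for
  \<open>mult\<close> read through \<open>\<phi>\<close>. Later only the intertwining of the two
  products has to be checked, never the axioms for \<open>mult'\<close>.\<close>

lemma (in transposed_poisson_algebra) isomorphism_transport:
  assumes add: "\<And>u v. \<phi> (u + v) = \<phi> u + \<phi> v" and scale: "\<And>a u. \<phi> (scale a u) = scale a (\<phi> u)"
    and bij: "bij \<phi>" and bracket: "\<And>u v. \<phi> (bracket u v) = bracket (\<phi> u) (\<phi> v)"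
    and mult: "\<And>u v. \<phi> (mult u v) = mult' (\<phi> u) (\<phi> v)"
  shows "transposed_poisson_isomorphism scale bracket mult scale bracket mult' \<phi>"
proof -
  have linearI: "Vector_Spaces.linear scale scale g"
    if "\<And>u v. g (u + v) = g u + g v" "\<And>a u. g (scale a u) = scale a (g u)" for g
    using that by unfold_locales auto
  have surj: "\<exists>w. \<phi> w = u" for u using bij by (metis bij_pointE)
  have mult'_add_left: "mult' (u + v) w = mult' u w + mult' v w"
    and mult'_add_right: "mult' w (u + v) = mult' w u + mult' w v"
    and mult'_commute: "mult' u v = mult' v u"
    and mult'_assoc: "mult' (mult' u v) w = mult' u (mult' v w)"
    and leibniz: "scale 2 (mult' w (bracket u v)) = bracket (mult' w u) v + bracket u (mult' w v)"
    and mult'_scale_left: "mult' (scale a u) w = scale a (mult' u w)"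
    and mult'_scale_right: "mult' w (scale a u) = scale a (mult' w u)" for a u v w
  proof -
    obtain u' v' w' where "u = \<phi> u'" "v = \<phi> v'" "w = \<phi> w'" using surj by metis
    note * = this add[symmetric] scale[symmetric] mult[symmetric] bracket[symmetric] prod.bilinear_simps
    show "mult' (u + v) w = mult' u w + mult' v w" "mult' w (u + v) = mult' w u + mult' w v"
      "mult' (scale a u) w = scale a (mult' u w)" "mult' w (scale a u) = scale a (mult' w u)"
      by (simp_all only: *)
    show "mult' u v = mult' v u" by (simp only: * prod.mult_commute)
    show "mult' (mult' u v) w = mult' u (mult' v w)" by (simp only: * prod.mult_assoc)
    show "scale 2 (mult' w (bracket u v)) = bracket (mult' w u) v + bracket u (mult' w v)"
      by (simp only: * transposed_leibniz)
  qed
  have "comm_assoc_algebra scale mult'"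
    by (intro comm_assoc_algebra.intro bilinear_operation.intro bilinear_operation_axioms.intro
        comm_assoc_algebra_axioms.intro linearI lie.vector_space_axioms mult'_add_left mult'_add_right
        mult'_scale_left mult'_scale_right mult'_commute mult'_assoc)
  then have "transposed_poisson_algebra scale bracket mult'"
    by (intro transposed_poisson_algebra.intro transposed_poisson_algebra_axioms.intro
        lie.lie_algebra_axioms leibniz)
  then show ?thesis
    by (intro transposed_poisson_isomorphism.intro transposed_poisson_isomorphism_axioms.intro
        transposed_poisson_algebra_axioms linearI assms)
qed

section \<open>Coordinates with respect to the basis\<close>

context lie_algebra_r
begin

context
  notes One_nat_def [simp del]
begin

text \<open>The index \<open>0\<close> stands for \<open>x\<close>; \<open>coord k\<close> is meaningful only for \<open>k \<le> 2 * n\<close>.\<close>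

definition basis_vec :: "nat \<Rightarrow> 'a" where "basis_vec i = (if i = 0 then x else e i)"

definition coord :: "nat \<Rightarrow> 'a \<Rightarrow> complex"
  where "coord k v = representation (insert x (e ` {1..2 * n})) v (basis_vec k)"

lemma basis_eq: "insert x (e ` {1..2 * n}) = basis_vec ` {..2 * n}"
proof -
  have "{..2 * n} = insert 0 {1..2 * n}" by auto
  then show ?thesis by (auto simp: basis_vec_def)
qed

lemma basis_vec_inj: "inj_on basis_vec {..2 * n}"
proof (rule inj_onI)
  fix i j assume *: "i \<in> {..2 * n}" "j \<in> {..2 * n}" "basis_vec i = basis_vec j"
  have "x \<noteq> e k" if "k \<in> {..2 * n}" "k \<noteq> 0" for k
    using basis_distinct(2) that by force
  then show "i = j"
    using * inj_onD[OF basis_distinct(1), of i j] by (fastforce simp: basis_vec_def split: if_splits)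
qed

lemma coord_add: "coord k (u + v) = coord k u + coord k v"
  unfolding coord_def using basis_independent basis_span by (simp add: representation_add)

lemma coord_scale: "coord k (scale a u) = a * coord k u"
  unfolding coord_def using basis_independent basis_span by (simp add: representation_scale)

lemma coord_zero: "coord k 0 = 0"
  using coord_scale[of k 0 0] by simp

lemma coord_minus: "coord k (- u) = - coord k u"
  using coord_scale[of k "-1" u] by simp

lemma coord_diff: "coord k (u - v) = coord k u - coord k v"
  using coord_add[of k u "- v"] by (simp add: coord_minus)

lemma coord_basis_vec: "k \<le> 2 * n \<Longrightarrow> j \<le> 2 * n \<Longrightarrow> coord k (basis_vec j) = (if k = j then 1 else 0)"
  unfolding coord_def using basis_independent inj_onD[OF basis_vec_inj, of k j]
  unfolding basis_eq by (subst representation_basis) auto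

lemma coord_e: "k \<le> 2 * n \<Longrightarrow> 1 \<le> j \<Longrightarrow> j \<le> 2 * n \<Longrightarrow> coord k (e j) = (if k = j then 1 else 0)"
  using coord_basis_vec[of k j] by (simp add: basis_vec_def)

lemma coord_x: "k \<le> 2 * n \<Longrightarrow> coord k x = (if k = 0 then 1 else 0)"
  using coord_basis_vec[of k 0] by (simp add: basis_vec_def)

lemmas coord_simps = coord_add coord_scale coord_zero coord_minus coord_diff coord_e coord_x

text \<open>Reduces identities that are linear in a vector to basis vectors. The zero vector comes
  from scaling \<open>x\<close> by \<open>0\<close>.\<close>

lemma basis_induct [consumes 0, case_names x e add scale]:
  assumes "P x" and "\<And>i. 1 \<le> i \<Longrightarrow> i \<le> 2 * n \<Longrightarrow> P (e i)"
    and add: "\<And>u v. P u \<Longrightarrow> P v \<Longrightarrow> P (u + v)" and scale: "\<And>a u. P u \<Longrightarrow> P (scale a u)"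
  shows "P v"
proof -
  have zero: "P 0" using scale[OF assms(1), of 0] by simp
  have "v \<in> span (insert x (e ` {1..2 * n}))" unfolding basis_span by simp
  then show ?thesis
    by (induction rule: span_induct_alt) (use assms zero in auto)
qed

lemma coord_eqI: "(\<And>k. k \<le> 2 * n \<Longrightarrow> coord k u = coord k v) \<Longrightarrow> u = v"
proof -
  assume *: "\<And>k. k \<le> 2 * n \<Longrightarrow> coord k u = coord k v"
  have exp: "w = (\<Sum>k\<le>2 * n. scale (coord k w) (basis_vec k))" for w
  proof (induction w rule: basis_induct)
    case x
    have "(\<Sum>k\<le>2 * n. scale (coord k x) (basis_vec k)) = (\<Sum>k\<le>2 * n. if k = 0 then x else 0)"
      by (intro sum.cong refl) (auto simp: coord_x basis_vec_def)
    then show ?case by simp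
  next
    case (e i)
    have "(\<Sum>k\<le>2 * n. scale (coord k (e i)) (basis_vec k)) = (\<Sum>k\<le>2 * n. if k = i then e i else 0)"
      using e by (intro sum.cong refl) (auto simp: coord_e basis_vec_def)
    then show ?case using e by simp
  next
    case (add u v)
    then show ?case by (simp add: coord_add scale_left_distrib sum.distrib)
  next
    case (scale a u)
    have "(\<Sum>k\<le>2 * n. scale (coord k (scale a u)) (basis_vec k)) = scale a (\<Sum>k\<le>2 * n. scale (coord k u) (basis_vec k))"
      by (simp add: coord_scale scale_sum_right)
    then show ?case using scale by simp
  qed
  show "u = v"
    by (subst exp[of u], subst exp[of v]) (intro sum.cong refl, simp add: *)
qed

section \<open>Brackets in coordinates\<close>

text \<open>Above \<open>n\<close>, antisymmetry contributes a sign. It fits the same formula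
  because \<open>i\<close> and \<open>2 * n + 1 - i\<close> have opposite parity.\<close>

lemma bracket_opposite:
  assumes "2 \<le> i" "i \<le> 2 * n - 1"
  shows "bracket (e i) (e (2 * n + 1 - i)) = scale ((- 1) ^ i) (e (2 * n))"
proof (cases "i \<le> n")
  case True
  then show ?thesis using assms bracket_e_opposite by simp
next
  case False
  define j where "j = 2 * n + 1 - i"
  have j: "2 \<le> j" "j \<le> n" "2 * n + 1 - j = i" "i + j = 2 * n + 1" using assms False by (auto simp: j_def)
  have "(-1::complex) ^ i * (-1) ^ j = - 1"
    by (simp only: power_add[symmetric] j(4)) simp
  then have "(-1::complex) ^ i = - ((-1) ^ j)" 
    by (cases "even j") (auto simp: eq_neg_iff_add_eq_0)
  then show ?thesis
    using bracket_e_opposite[OF j(1,2)] bracket_antisym[of "e i" "e j"] unfolding j(3) j_def[symmetric] by simp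
qed

lemma bracket_e_e_zero':
  assumes "2 \<le> i" "i \<le> 2 * n" "2 \<le> j" "j \<le> 2 * n" "i + j \<noteq> 2 * n + 1"
  shows "bracket (e i) (e j) = 0"
proof -
  consider "i < j" | "i = j" | "j < i" by linarith
  then show ?thesis
  proof cases
    case 1
    show ?thesis by (rule bracket_e_e_zero) (use assms 1 in auto)
  next
    case 2
    then show ?thesis by (simp add: bracket_self)
  next
    case 3
    have "bracket (e j) (e i) = 0" by (rule bracket_e_e_zero) (use assms 3 in auto)
    then show ?thesis using bracket_antisym[of "e i"] by simp
  qed
qed

lemma bracket_e_last: "2 \<le> n \<Longrightarrow> bracket (e (2 * n - 1)) (e 1) = 0"
  using bracket_antisym[of "e (2 * n - 1)" "e 1"] bracket_e_e_zero[of 1 "2 * n - 1"] by auto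

lemma bracket_e2n_e1: "2 \<le> n \<Longrightarrow> bracket (e (2 * n)) (e 1) = 0"
  using bracket_antisym[of "e (2 * n)" "e 1"] bracket_e_e_zero[of 1 "2 * n"] by auto

text \<open>The three terms are the weight under \<open>x\<close>, the shift by \<open>e 1\<close>,
  which stops at \<open>e (2 * n - 1)\<close>, and the pairing into \<open>e (2 * n)\<close>. Both
  sides are linear in \<open>v\<close>, so basis vectors suffice.\<close>

lemma bracket_mid:
  assumes "2 \<le> n" "2 \<le> i" "i \<le> 2 * n - 1"
  shows "bracket (e i) v = scale ((of_nat i - of_nat n) * coord 0 v) (e i)
    + scale (coord 1 v) (if i \<le> 2 * n - 2 then e (i + 1) else 0)
    + scale ((- 1) ^ i * coord (2 * n + 1 - i) v) (e (2 * n))"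
proof (induction v rule: basis_induct)
  case x
  then show ?case using assms by (auto simp: coord_x bracket_e_x)
next
  case (e j)
  consider "j = 1" "i \<le> 2 * n - 2" | "j = 1" "i = 2 * n - 1" | "2 \<le> j" "j = 2 * n + 1 - i"
    | "2 \<le> j" "j + i \<noteq> 2 * n + 1"
    using assms e by linarith
  then show ?case
  proof cases
    case 1
    then show ?thesis using assms by (auto simp: coord_e bracket_e_e1)
  next
    case 2
    then show ?thesis using assms by (auto simp: coord_e bracket_e_last)
  next
    case 3
    then show ?thesis using assms e by (auto simp: coord_e bracket_opposite)
  next
    case 4
    then show ?thesis using assms e by (auto simp add: coord_e bracket_e_e_zero')
  qed
next
  case (add u v)
  then show ?case by (simp add: bilinear_simps coord_add distrib_left scale_left_distrib ac_simps)
next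
  case (scale a u)
  then show ?case by (simp add: bilinear_simps coord_scale scale_right_distrib mult.left_commute)
qed

lemma bracket_last:
  assumes "2 \<le> n"
  shows "bracket (e (2 * n)) v = scale (coord 0 v) (e (2 * n))"
proof (induction v rule: basis_induct)
  case x
  then show ?case using assms by (simp add: coord_x bracket_e2n_x)
next
  case (e j)
  then show ?case using assms bracket_e_e_zero'[of "2 * n" j] 
    by (cases "j = 1") (auto simp: coord_e bracket_e2n_e1)
next
  case (add u v)
  then show ?case by (simp add: bilinear_simps coord_add scale_left_distrib)
next
  case (scale a u)
  then show ?case by (simp add: bilinear_simps coord_scale)
qed

lemma coord_bracket_x:
  assumes "2 \<le> n" "k \<le> 2 * n"
  shows "coord k (bracket v x) = (if k = 0 then 0 else if k = 1 then coord 1 v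
    else if k = 2 * n then coord (2 * n) v + \<epsilon> * coord 1 v else (of_nat k - of_nat n) * coord k v)"
proof (induction v rule: basis_induct)
  case x
  then show ?case using assms by (simp add: coord_simps bracket_self)
next
  case (e j)
  consider "j = 1" | "j = 2 * n" | "2 \<le> j" "j \<le> 2 * n - 1" using e by linarith
  then show ?case
    by cases (use assms in \<open>auto simp: coord_simps bracket_e1_x bracket_e2n_x bracket_e_x\<close>)
next
  case (add u v)
  then show ?case by (simp add: bilinear_simps coord_add algebra_simps)
next
  case (scale a u)
  then show ?case by (simp add: bilinear_simps coord_scale algebra_simps)
qed

lemma coord_bracket_e1:
  assumes "2 \<le> n" "k \<le> 2 * n"
  shows "coord k (bracket v (e 1)) = (if k = 1 then - coord 0 v else if k = 2 * n then - \<epsilon> * coord 0 v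
    else if 3 \<le> k then coord (k - 1) v else 0)"
proof (induction v rule: basis_induct)
  case x
  then show ?case
    using assms by (auto simp: bracket_antisym[of x "e 1"] coord_simps bracket_e1_x)
next
  case (e j)
  consider "j = 1" | "j = 2 * n" | "j = 2 * n - 1" "2 \<le> j"| "2 \<le> j" "j \<le> 2 * n - 2" using e by linarith
  then show ?case
    by cases (use assms in \<open>auto simp: coord_simps bracket_self bracket_e2n_e1 bracket_e_last bracket_e_e1
     \<close>)
next
  case (add u v)
  then show ?case by (simp add: bilinear_simps coord_add algebra_simps)
next
  case (scale a u)
  then show ?case by (simp add: bilinear_simps coord_scale algebra_simps)
qed

lemma coord_bracket_e1_left:
  assumes "2 \<le> n" "k \<le> 2 * n"
  shows "coord k (bracket (e 1) v) = (if k = 1 then coord 0 v else if k = 2 * n then \<epsilon> * coord 0 v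
    else if 3 \<le> k then - coord (k - 1) v else 0)"
  using coord_bracket_e1[OF assms, of v] bracket_antisym[of "e 1" v] by (auto simp: coord_minus)

lemma coord_bracket_mid:
  assumes "2 \<le> n" "2 \<le> i" "i \<le> 2 * n - 1" "k \<le> 2 * n"
  shows "coord k (bracket (e i) v) = (if k = i then (of_nat i - of_nat n) * coord 0 v else 0)
    + (if i \<le> 2 * n - 2 \<and> k = i + 1 then coord 1 v else 0)
    + (if k = 2 * n then (- 1) ^ i * coord (2 * n + 1 - i) v else 0)"
  using assms by (auto simp: bracket_mid coord_simps)

section \<open>Half-derivations\<close>

text \<open>
  With \<open>w i\<close> the weight of \<open>e i\<close> under \<open>x\<close>, the identity for \<open>[e i, x]\<close> expresses
  \<open>(2 * w i - w k) * coord k (f (e i))\<close> through the coordinates of \<open>f x\<close>; the identities for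
  \<open>[e i, e 1] = e (i + 1)\<close> then eliminate the coordinates \<open>2, \<dots>, 2 * n - 2\<close> of \<open>f x\<close>
  one after the other.
\<close>

lemma half_derivation_normal:
  assumes n3: "3 \<le> n"
    and f_add: "\<And>u v. f (u + v) = f u + f v"
    and f_scale: "\<And>a u. f (scale a u) = scale a (f u)"
    and half: "\<And>u v. scale 2 (f (bracket u v)) = bracket (f u) v + bracket u (f v)"
    and y0: "coord 0 (f x) = 0"
  obtains \<beta> \<gamma> where "f x = scale ((3 - 2 * of_nat n) * \<beta>) (e (2 * n - 1)) + scale \<gamma> (e (2 * n))"
    "f (e 1) = 0" "f (e 2) = scale \<beta> (e (2 * n))" "\<And>i. 3 \<le> i \<Longrightarrow> i \<le> 2 * n \<Longrightarrow> f (e i) = 0"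
proof -
  have n2: "2 \<le> n" using n3 by simp
  have nz: "of_nat i - of_nat j \<noteq> (0::complex)" if "i \<noteq> j" for i j
    using that by simp
  define y p q where "y = f x" and "p = f (e 1)" and "q i = f (e i)" for i
  have half_coord: "2 * coord k (f (bracket u v)) = coord k (bracket (f u) v) + coord k (bracket u (f v))" for k u v
    using arg_cong[OF half[of u v], of "coord k"] by (simp add: coord_simps)
  have ex: "2 * (of_nat i - of_nat n) * coord k (q i) =
      (if k = 0 then 0 else if k = 1 then coord 1 (q i) else if k = 2 * n then coord (2 * n) (q i) + \<epsilon> * coord 1 (q i)
        else (of_nat k - of_nat n) * coord k (q i))
      + (if i \<le> 2 * n - 2 \<and> k = i + 1 then coord 1 y else 0)
      + (if k = 2 * n then (- 1) ^ i * coord (2 * n + 1 - i) y else 0)"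
    if "2 \<le> i" "i \<le> 2 * n - 1" "k \<le> 2 * n" for i k
  proof -
    have "2 * ((of_nat i - of_nat n) * coord k (q i)) = coord k (bracket (q i) x) + coord k (bracket (e i) y)"
      using half_coord[of k "e i" x] by (simp add: bracket_e_x that f_scale coord_scale q_def y_def)
    then show ?thesis
      using y0 unfolding y_def[symmetric] coord_bracket_x[OF n2 that(3)] coord_bracket_mid[OF n2 that]
      by (simp only: mult.assoc add.assoc mult_zero_right if_cancel add_0)
  qed

  have n_2: "of_nat n \<noteq> (2::complex)" using nz[of n 2] n3 by simp
  have q2_0: "coord 0 (q 2) = 0"
    using ex[of 2 0] n3 n_2 by auto
  have q2_1: "coord 1 (q 2) = 0"
  proof -
    have "(of_nat (2 * n) - of_nat 3) * coord 1 (q 2) = 0"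
      using ex[of 2 1] n3 by (simp add: algebra_simps)
    moreover have "2 * n \<noteq> 3" by presburger
    ultimately show ?thesis using nz[of "2 * n" 3] by (metis mult_eq_0_iff)
  qed
  \<comment> \<open>The factor \<open>n + k - 4\<close> is the weight of \<open>e k\<close> minus
    twice that of \<open>e 2\<close>. Index \<open>3\<close> is left out because
    \<open>coord 1 y\<close> enters there through \<open>[e 2, e 1] = e 3\<close>.\<close>
  have q2_k: "coord k (q 2) = 0" if "2 \<le> k" "k \<le> 2 * n - 1" "k \<noteq> 3" for k
  proof -
    have "k \<le> 2 * n" "k \<noteq> 2 * n" using n3 that(2) by linarith+
    then have "(of_nat (n + k) - of_nat 4) * coord k (q 2) = 0"
      using ex[of 2 k] n3 that by (simp add: algebra_simps)
    moreover have "n + k \<noteq> 4" using n3 that by simp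
    ultimately show ?thesis using nz[of "n + k" 4] by (metis mult_eq_0_iff)
  qed
  have q2_3: "(1 - of_nat n) * coord 3 (q 2) = coord 1 y"
  proof -
    have "2 * (2 - of_nat n) * coord 3 (q 2) = (3 - of_nat n) * coord 3 (q 2) + coord 1 y"
      using ex[of 2 3] n3 by auto
    then show ?thesis by algebra
  qed
  \<comment> \<open>The constant \<open>3 - 2n\<close> arises here: twice the weight
    \<open>2 - n\<close> of \<open>e 2\<close>, minus the weight \<open>1\<close> of
    \<open>e (2 * n)\<close>.\<close>
  have q2_2n: "coord (2 * n - 1) y = (3 - 2 * of_nat n) * coord (2 * n) (q 2)"
  proof -
    have "2 * (2 - of_nat n) * coord (2 * n) (q 2) = coord (2 * n) (q 2) + coord (2 * n - 1) y"
      using ex[of 2 "2 * n"] n3 q2_1 by (auto simp: One_nat_def)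
    then show ?thesis by algebra
  qed

  have q2n: "f (e (2 * n)) = 0"
  proof (rule coord_eqI)
    fix k assume k: "k \<le> 2 * n"
    have "bracket (e (2 * n)) y = 0" using bracket_last[OF n2, of y] y0 by (simp add: y_def)
    then have eq: "2 * coord k (q (2 * n)) = coord k (bracket (q (2 * n)) x)" if "k \<le> 2 * n" for k
      using half_coord[of k "e (2 * n)" x] by (simp add: bracket_e2n_x q_def y_def coord_zero)
    have 1: "coord 1 (q (2 * n)) = 0"
      using eq[of 1] n3 coord_bracket_x[OF n2, of 1] by simp
    consider "k = 0" | "k = 1" | "k = 2 * n" | "2 \<le> k" "k \<le> 2 * n - 1" "k \<noteq> n + 2" | "k = n + 2"
      using k by linarith
    then have "coord k (q (2 * n)) = 0"
    proof cases
      case 4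
      then have "2 * coord k (q (2 * n)) = (of_nat k - of_nat n) * coord k (q (2 * n))"
        using eq[of k] k n3 coord_bracket_x[OF n2 k, of "q (2 * n)"] by auto
      then have "(of_nat k - of_nat (n + 2)) * coord k (q (2 * n)) = 0"
        by (simp add: algebra_simps)
      then show ?thesis using nz[of k "n + 2"] 4 by (metis mult_eq_0_iff)
    next
      case 5
      \<comment> \<open>At \<open>k = n + 2\<close> the weight is \<open>2\<close>, twice that of
        \<open>e (2 * n)\<close>, so the identity for \<open>[e (2 * n), x]\<close> is void. Writing
        \<open>e (2 * n)\<close> as \<open>[e 2, e (2 * n - 1)]\<close> helps: the images of
        \<open>ad e 2\<close> and \<open>ad (e (2 * n - 1))\<close> miss \<open>e (n + 2)\<close>,
        except that for \<open>n = 3\<close> it equals \<open>e (2 * n - 1)\<close>, whose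
        coefficient vanishes by \<open>q2_0\<close>.\<close>
      have "bracket (e 2) (e (2 * n - 1)) = e (2 * n)" using bracket_opposite[of 2] n3 by (simp add: One_nat_def)
      moreover have "coord k (bracket (e 2) (q (2 * n - 1))) = 0"
        using 5 n3 by (subst coord_bracket_mid) auto
      moreover have "coord k (bracket (e (2 * n - 1)) (q 2)) = 0"
        using 5 n3 q2_0 by (subst coord_bracket_mid) auto
      ultimately show ?thesis using half_coord[of k "e 2" "e (2 * n - 1)"]
          bracket_antisym[of "q 2" "e (2 * n - 1)"] by (simp add: q_def coord_minus)
    qed (use eq[of k] 1 coord_bracket_x[OF n2 k, of "q (2 * n)"] n3 in auto)
    then show "coord k (f (e (2 * n))) = coord k 0" by (simp add: q_def coord_zero)
  qed

  \<comment> \<open>The \<open>\<epsilon>\<close>-term of \<open>[e 1, x]\<close> drops out on the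
    left because \<open>f (e (2 * n)) = 0\<close> is already known.\<close>
  have ep: "2 * coord k p = coord k (bracket p x) + coord k (bracket (e 1) y)" for k
    using half_coord[of k "e 1" x] by (simp add: bracket_e1_x p_def y_def coord_simps f_add f_scale q2n)
  have p_0: "coord 0 p = 0"
    using ep[of 0] coord_bracket_x[OF n2, of 0 p] coord_bracket_e1_left[OF n2, of 0 y] n3 by auto
  have p_1: "coord 1 p = 0"
    using ep[of 1] coord_bracket_x[OF n2, of 1 p] coord_bracket_e1_left[OF n2, of 1 y] n3 y0 by (simp add: y_def)
  have p_2: "coord 2 p = 0"
  proof -
    have "2 * coord 2 p = (2 - of_nat n) * coord 2 p"
      using ep[of 2] coord_bracket_x[OF n2, of 2 p] coord_bracket_e1_left[OF n2, of 2 y] n3 by auto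
    then have "of_nat n * coord 2 p = 0" by algebra
    then show ?thesis using n3 by simp
  qed
  have p_2n: "coord (2 * n) p = 0"
    using ep[of "2 * n"] coord_bracket_x[OF n2, of "2 * n" p] coord_bracket_e1_left[OF n2, of "2 * n" y] n3 y0 p_1
    by (simp add: y_def)
  \<comment> \<open>The relation is kept undivided since its factor vanishes at
    \<open>k = n + 2\<close>.\<close>
  have p_k: "(2 + of_nat n - of_nat k) * coord k p = - coord (k - 1) y" if "3 \<le> k" "k \<le> 2 * n - 1" for k
  proof -
    have "2 * coord k p = (of_nat k - of_nat n) * coord k p - coord (k - 1) y"
      using ep[of k] coord_bracket_x[OF n2, of k p] coord_bracket_e1_left[OF n2, of k y] that by auto
    then show ?thesis by algebra
  qed

  \<comment> \<open>\<open>coord 1 y\<close> is expressed through \<open>coord 3 (q 2)\<close> and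
    through \<open>coord 4 (q 3)\<close>. As \<open>[e 2, e 1] = e 3\<close> links these two,
    comparing the expressions leaves \<open>n * coord 4 (q 3) = 0\<close>.\<close>
  have y1: "coord 1 y = 0"
  proof -
    have "bracket (e 2) (e 1) = e 3" using bracket_e_e1[of 2] n3 by simp
    then have "2 * coord 4 (q 3) = coord 3 (q 2)"
      using half_coord[of 4 "e 2" "e 1"] n3 coord_bracket_e1[OF n2, of 4 "q 2"]
        coord_bracket_mid[OF n2, of 2 4 p]
      by (simp add: q_def p_def)
    moreover have "(2 - of_nat n) * coord 4 (q 3) = coord 1 y"
    proof -
      have "2 * (3 - of_nat n) * coord 4 (q 3) = (4 - of_nat n) * coord 4 (q 3) + coord 1 y"
        using ex[of 3 4] n3 by auto
      then show ?thesis by algebra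
    qed
    moreover have "of_nat n * coord 4 (q 3) = (2 - of_nat n) * coord 4 (q 3) - (1 - of_nat n) * (2 * coord 4 (q 3))"
      by (simp add: algebra_simps)
    ultimately have "of_nat n * coord 4 (q 3) = 0"
      using q2_3 by simp
    then show ?thesis using n3 \<open>(2 - of_nat n) * coord 4 (q 3) = coord 1 y\<close> by simp
  qed
  have "of_nat n \<noteq> (1::complex)" using nz[of n 1] n3 by simp
  then have "coord 3 (q 2) = 0" using q2_3 y1 by simp
  then have q2_low: "coord k (q 2) = 0" if "k < 2 * n" for k
  proof -
    consider "k = 0" | "k = 1" | "k = 3" | "2 \<le> k" "k \<noteq> 3" by linarith
    then show ?thesis
      by cases (use \<open>coord 3 (q 2) = 0\<close> q2_0 q2_1 q2_k[of k] that in auto)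
  qed
  have q2: "q 2 = scale (coord (2 * n) (q 2)) (e (2 * n))"
  proof (rule coord_eqI)
    fix k assume "k \<le> 2 * n"
    then show "coord k (q 2) = coord k (scale (coord (2 * n) (q 2)) (e (2 * n)))"
      using n3 q2_low[of k] by (cases "k = 2 * n") (auto simp: coord_simps)
  qed

  \<comment> \<open>Once \<open>[q i, e 1]\<close> vanishes, \<open>2 * q (i + 1) = [e i, p]\<close>
    is a multiple of \<open>e (2 * n)\<close>, and three linear relations tie that multiple to one
    coordinate each of \<open>p\<close> and \<open>y\<close>.\<close>
  have next_zero: "q (i + 1) = 0 \<and> coord (2 * n + 1 - i) p = 0 \<and> coord (2 * n - i) y = 0"
    if i: "2 \<le> i" "i \<le> 2 * n - 2" and qi: "bracket (q i) (e 1) = 0" for i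
  proof -
    define P Y Q s where "P = coord (2 * n + 1 - i) p" and "Y = coord (2 * n - i) y"
      and "Q = coord (2 * n) (q (i + 1))" and "s = (- 1 :: complex) ^ i"
    have s: "s \<noteq> 0" by (simp add: s_def)
    have "bracket (e i) p = scale (s * P) (e (2 * n))"
      using i n2 p_0 p_1 by (simp add: bracket_mid P_def s_def)
    then have 2: "scale 2 (q (i + 1)) = scale (s * P) (e (2 * n))"
      using half[of "e i" "e 1"] i qi by (simp add: bracket_e_e1 q_def p_def)
    have Q: "2 * Q = s * P" using arg_cong[OF 2, of "coord (2 * n)"] n3 by (simp add: coord_simps Q_def)
    have q_1: "coord 1 (q (i + 1)) = 0" using arg_cong[OF 2, of "coord 1"] n3 by (simp add: coord_simps)
    have "(2 * of_nat i + 1 - 2 * of_nat n) * Q = - (s * Y)"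
    proof -
      have "i + 1 \<noteq> 2 * n" "i + 1 \<le> 2 * n - 1" using i n3 by linarith+
      then have "2 * (of_nat (i + 1) - of_nat n) * Q = Q + - s * Y"
        using ex[of "i + 1" "2 * n"] i n3 q_1 y1
        by (simp add: Q_def s_def Y_def power_add)
      then have "2 * (of_nat i + 1 - of_nat n) * Q = Q + - s * Y"
        by (simp add: add.commute)
      then show ?thesis by algebra
    qed
    moreover have "(1 - of_nat n + of_nat i) * P = - Y"
      using p_k[of "2 * n + 1 - i"] i by (simp add: P_def Y_def of_nat_diff algebra_simps)
    \<comment> \<open>Eliminating \<open>Q\<close> and \<open>Y\<close> leaves \<open>P\<close> with
      coefficient \<open>2(1 - n + i) - (2i + 1 - 2n) = 1\<close>, so no index is exceptional, not
      even \<open>i = n - 1\<close>.\<close>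
    moreover have "s * P = 2 * (s * ((1 - of_nat n + of_nat i) * P)) - (2 * of_nat i + 1 - 2 * of_nat n) * (s * P)"
      by (simp add: algebra_simps)
    moreover have "(2 * of_nat i + 1 - 2 * of_nat n) * (s * P) = 2 * ((2 * of_nat i + 1 - 2 * of_nat n) * Q)"
      by (simp only: Q[symmetric] mult.left_commute)
    ultimately have "s * P = 0" by simp
    then have "P = 0" using s by simp
    moreover from this have "Y = 0" using \<open>(1 - of_nat n + of_nat i) * P = - Y\<close> by simp
    moreover have "q (i + 1) = 0" using 2 \<open>P = 0\<close> by simp
    ultimately show ?thesis by (simp add: P_def Y_def)
  qed
  \<comment> \<open>The induction starts because \<open>q 2\<close> is a multiple of
    \<open>e (2 * n)\<close>, which commutes with \<open>e 1\<close>. Afterwards each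
    \<open>q (i + 1)\<close> is \<open>0\<close>.\<close>
  have all: "q (i + 1) = 0 \<and> coord (2 * n + 1 - i) p = 0 \<and> coord (2 * n - i) y = 0"
    if "2 \<le> i" "i \<le> 2 * n - 2" for i
    using that
  proof (induction i rule: dec_induct)
    case base
    have "bracket (q 2) (e 1) = 0"
      by (subst q2) (simp add: bilinear_simps bracket_e2n_e1[OF n2])
    then show ?case using next_zero[of 2] n3 by simp
  next
    case (step i)
    then have "bracket (q (i + 1)) (e 1) = 0" by (simp add: bilinear_simps)
    then show ?case using next_zero[of "i + 1"] step.hyps step.prems unfolding Suc_eq_plus1 by simp
  qed
  show thesis
  proof
    show "f x = scale ((3 - 2 * of_nat n) * coord (2 * n) (q 2)) (e (2 * n - 1)) + scale (coord (2 * n) y) (e (2 * n))"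
    proof (rule coord_eqI)
      fix k assume k: "k \<le> 2 * n"
      consider "k = 0" | "k = 1" | "2 \<le> k" "k \<le> 2 * n - 2" | "k = 2 * n - 1" | "k = 2 * n"
        using k by linarith
      then show "coord k (f x) = coord k (scale ((3 - 2 * of_nat n) * coord (2 * n) (q 2)) (e (2 * n - 1))
          + scale (coord (2 * n) y) (e (2 * n)))"
      proof cases
        case 3
        then have "coord k y = 0" "k \<noteq> 2 * n - 1" "k \<noteq> 2 * n" using all[of "2 * n - k"] n3 by auto
        then show ?thesis using 3 n3 by (simp add: coord_simps y_def)
      qed (use n3 y0 y1 q2_2n in \<open>auto simp: coord_simps y_def\<close>)
    qed
    show "f (e 1) = 0"
    proof (rule coord_eqI)
      fix k assume k: "k \<le> 2 * n"
      consider "k = 0" | "k = 1" | "k = 2" | "3 \<le> k" "k \<le> 2 * n - 1" | "k = 2 * n"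
        using k by linarith
      then show "coord k (f (e 1)) = coord k 0"
      proof cases
        case 4
        then have "coord k p = 0" using all[of "2 * n + 1 - k"] by simp
        then show ?thesis by (simp add: coord_zero p_def)
      qed (use p_0 p_1 p_2 p_2n in \<open>auto simp: coord_zero p_def\<close>)
    qed
    show "f (e 2) = scale (coord (2 * n) (q 2)) (e (2 * n))" using q2 by (simp add: q_def)
    show "f (e i) = 0" if "3 \<le> i" "i \<le> 2 * n" for i
    proof (cases "i = 2 * n")
      case False
      then show ?thesis using that all[of "i - 1"] by (simp add: q_def)
    qed (simp add: q2n)
  qed
qed

text \<open>The identity is a half-derivation, so subtracting \<open>l\<close> times it removes the
  \<open>x\<close>-coordinate of \<open>f x\<close> and puts the difference \<open>g\<close> in
  normal form.\<close>

lemma half_derivation_form: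
  assumes n3: "3 \<le> n"
    and f_add: "\<And>u v. f (u + v) = f u + f v"
    and f_scale: "\<And>a u. f (scale a u) = scale a (f u)"
    and half: "\<And>u v. scale 2 (f (bracket u v)) = bracket (f u) v + bracket u (f v)"
  shows "\<exists>l \<beta> \<gamma>. \<forall>v. f v = scale l v + scale ((3 - 2 * of_nat n) * \<beta> * coord 0 v) (e (2 * n - 1))
    + scale (\<gamma> * coord 0 v + \<beta> * coord 2 v) (e (2 * n))"
proof -
  define l where "l = coord 0 (f x)"
  define g where "g v = f v - scale l v" for v
  have g_add: "g (u + v) = g u + g v" for u v
    by (simp add: g_def f_add scale_right_distrib)
  have g_scale: "g (scale a u) = scale a (g u)" for a u
    by (simp add: g_def f_scale scale_right_diff_distrib mult.commute)
  have eq: "f v = g v + scale l v" for v by (simp add: g_def)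
  have two: "scale (2 * a) v = scale a v + scale a v" for a v
    by (simp add: scale_left_distrib[symmetric])
  have g_half: "scale 2 (g (bracket u v)) = bracket (g u) v + bracket u (g v)" for u v
    using half[of u v] unfolding eq by (simp add: bilinear_simps scale_right_distrib two)
  have "coord 0 (g x) = 0" by (simp add: g_def coord_simps l_def)
  then obtain \<beta> \<gamma> where gx: "g x = scale ((3 - 2 * of_nat n) * \<beta>) (e (2 * n - 1)) + scale \<gamma> (e (2 * n))"
    and ge: "g (e 1) = 0" "g (e 2) = scale \<beta> (e (2 * n))"
    "\<And>i. 3 \<le> i \<Longrightarrow> i \<le> 2 * n \<Longrightarrow> g (e i) = 0"
    using half_derivation_normal[of g, OF n3 g_add g_scale g_half] by metis
  have g_form: "g v = scale ((3 - 2 * of_nat n) * \<beta> * coord 0 v) (e (2 * n - 1))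
    + scale (\<gamma> * coord 0 v + \<beta> * coord 2 v) (e (2 * n))" for v
  proof (induction v rule: basis_induct)
    case x
    then show ?case using n3 by (simp add: gx coord_simps)
  next
    case (e i)
    consider "i = 1" | "i = 2" | "3 \<le> i" using e by linarith
    then show ?case by cases (use n3 e ge in \<open>auto simp: coord_simps\<close>)
  next
    case (add u v)
    then show ?case by (simp add: g_add coord_add scale_left_distrib distrib_left)
  next
    case (scale a u)
    then show ?case by (simp add: g_scale coord_scale scale_right_distrib distrib_left mult.left_commute)
  qed
  show ?thesis
  proof (intro exI allI)
    fix v
    show "f v = scale l v + scale ((3 - 2 * of_nat n) * \<beta> * coord 0 v) (e (2 * n - 1))
      + scale (\<gamma> * coord 0 v + \<beta> * coord 2 v) (e (2 * n))"
      unfolding eq[of v] g_form[of v] by (simp only: add_ac)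
  qed
qed

section \<open>The two-parameter family of products\<close>

text \<open>The parameter pairs \<open>(0, 1)\<close> and \<open>(1, 0)\<close> give the target
  tables \<open>TP1\<close> and \<open>TP2\<close>.\<close>

definition normal_mult :: "complex \<Rightarrow> complex \<Rightarrow> 'a \<Rightarrow> 'a \<Rightarrow> 'a"
  where "normal_mult \<beta> \<gamma> u v =
    scale ((3 - 2 * of_nat n) * \<beta> * (coord 0 u * coord 0 v)) (e (2 * n - 1))
    + scale (\<gamma> * (coord 0 u * coord 0 v) + \<beta> * (coord 0 u * coord 2 v + coord 2 u * coord 0 v)) (e (2 * n))"

text \<open>Multiplication by \<open>u\<close> is a half-derivation whose three parameters depend on
  \<open>u\<close>. Comparing coordinates of \<open>u \<cdot> x\<close> and
  \<open>x \<cdot> u\<close> expresses them through those of \<open>x\<close>.\<close>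

lemma transposed_poisson_normal_form:
  assumes n3: "3 \<le> n" and tp: "transposed_poisson_algebra scale bracket mult"
  shows "\<exists>\<beta> \<gamma>. \<forall>u v. mult u v = normal_mult \<beta> \<gamma> u v"
proof -
  interpret tp: transposed_poisson_algebra scale bracket mult by (rule tp)
  have "\<exists>l \<beta> \<gamma>. \<forall>v. mult u v = scale l v + scale ((3 - 2 * of_nat n) * \<beta> * coord 0 v) (e (2 * n - 1))
      + scale (\<gamma> * coord 0 v + \<beta> * coord 2 v) (e (2 * n))" for u
    by (rule half_derivation_form[OF n3]) (simp_all add: tp.prod.bilinear_simps tp.transposed_leibniz)
  then obtain l B G where form: "mult u v = scale (l u) v
      + scale ((3 - 2 * of_nat n) * B u * coord 0 v) (e (2 * n - 1))
      + scale (G u * coord 0 v + B u * coord 2 v) (e (2 * n))" for u v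
    by metis
  have com: "coord k (mult u v) = coord k (mult v u)" for k u v by (simp add: tp.prod.mult_commute)
  \<comment> \<open>In \<open>x \<cdot> e 1\<close> the coordinate at \<open>e 1\<close> is
    \<open>l x\<close>, whereas in \<open>e 1 \<cdot> x\<close> it is \<open>0\<close>.\<close>
  have "l x = 0" using com[of 1 x "e 1"] n3 by (auto simp: form coord_simps)
  then have l: "l u = 0" for u using com[of 0 u x] n3 by (auto simp: form coord_simps)
  have idx: "2 * n - 1 \<noteq> 2 * n" "2 * n - 1 \<noteq> 0" "2 * n - 1 \<noteq> 2" using n3 by linarith+
  have "(3 - 2 * of_nat n) * B u = (3 - 2 * of_nat n) * (B x * coord 0 u)" for u
    using com[of "2 * n - 1" u x] n3 idx by (simp add: form coord_simps l)
  moreover have "3 - 2 * of_nat n \<noteq> (0::complex)"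
  proof -
    have "2 * n \<noteq> 3" by presburger
    then have "of_nat (2 * n) \<noteq> (of_nat 3 :: complex)" unfolding of_nat_eq_iff .
    then show ?thesis by simp
  qed
  ultimately have B: "B u = B x * coord 0 u" for u by (metis mult_left_cancel)
  have G: "G u = G x * coord 0 u + B x * coord 2 u" for u
    using com[of "2 * n" u x] n3 idx by (simp add: form coord_simps l)
  have "mult u v = normal_mult (B x) (G x) u v" for u v
    unfolding form[of u v] normal_mult_def l B[of u] G[of u] by (simp add: algebra_simps)
  then show ?thesis by blast
qed

section \<open>Diagonal automorphisms\<close>

definition diag :: "(nat \<Rightarrow> complex) \<Rightarrow> 'a \<Rightarrow> 'a"
  where "diag d v = (\<Sum>k\<le>2 * n. scale (d k * coord k v) (basis_vec k))"

lemma coord_diag: "k \<le> 2 * n \<Longrightarrow> coord k (diag d v) = d k * coord k v"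
proof -
  assume k: "k \<le> 2 * n"
  have "coord k (\<Sum>i\<in>A. g i) = (\<Sum>i\<in>A. coord k (g i))" for g and A :: "nat set"
    by (induction A rule: infinite_finite_induct) (simp_all add: coord_zero coord_add)
  then have "coord k (diag d v) = (\<Sum>i\<le>2 * n. d i * coord i v * coord k (basis_vec i))"
    by (simp add: diag_def coord_scale)
  also have "\<dots> = (\<Sum>i\<le>2 * n. if i = k then d k * coord k v else 0)"
    using k by (intro sum.cong refl) (auto simp: coord_basis_vec)
  finally show ?thesis using k by simp
qed

lemma diag_add: "diag d (u + v) = diag d u + diag d v"
  by (rule coord_eqI) (simp add: coord_diag coord_add distrib_left)

lemma diag_scale: "diag d (scale a u) = scale a (diag d u)"
  by (rule coord_eqI) (simp add: coord_diag coord_scale)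

lemma diag_e: "1 \<le> i \<Longrightarrow> i \<le> 2 * n \<Longrightarrow> diag d (e i) = scale (d i) (e i)"
  by (rule coord_eqI) (simp add: coord_diag coord_scale coord_e)

lemma diag_x: "diag d x = scale (d 0) x"
  by (rule coord_eqI) (simp add: coord_diag coord_scale coord_x)

lemma diag_inverse:
  assumes "\<And>k. k \<le> 2 * n \<Longrightarrow> d k \<noteq> 0"
  shows "diag (\<lambda>k. 1 / d k) (diag d v) = v" "diag d (diag (\<lambda>k. 1 / d k) v) = v"
  by (rule coord_eqI, simp add: coord_diag assms)+

text \<open>The hypotheses are the bracket table read on eigenvalues: \<open>d_Suc\<close> serves
  \<open>[e i, e 1]\<close>, \<open>d_opp\<close> the pairing into \<open>e (2 * n)\<close>, and
  equal eigenvalues on \<open>e 1\<close> and \<open>e (2 * n)\<close> serve the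
  \<open>\<epsilon>\<close>-term of \<open>[e 1, x]\<close>.\<close>

lemma diag_bracket:
  assumes n2: "2 \<le> n" and d0: "d 0 = 1" and d1: "d 1 = a" and d2n: "d (2 * n) = a"
    and d_Suc: "\<And>i. 2 \<le> i \<Longrightarrow> i \<le> 2 * n - 2 \<Longrightarrow> d (i + 1) = d i * a"
    and d_opp: "\<And>i. 2 \<le> i \<Longrightarrow> i \<le> 2 * n - 1 \<Longrightarrow> d i * d (2 * n + 1 - i) = a"
  shows "diag d (bracket u v) = bracket (diag d u) (diag d v)"
proof -
  have mid: "diag d (bracket (e i) v) = bracket (diag d (e i)) (diag d v)"
    if "2 \<le> i" "i \<le> 2 * n - 1" for i v
  proof (rule coord_eqI)
    fix k assume k: "k \<le> 2 * n"
    have i: "i \<noteq> 2 * n" "i + 1 \<noteq> 2 * n \<or> \<not> i \<le> 2 * n - 2" "2 * n + 1 - i \<le> 2 * n" "1 \<le> 2 * n"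
      using that n2 by linarith+
    consider "k = i" | "k = i + 1" "i \<le> 2 * n - 2" | "k = 2 * n"
      | "k \<noteq> i" "\<not> (i \<le> 2 * n - 2 \<and> k = i + 1)" "k \<noteq> 2 * n"
      by blast
    then have "d k * coord k (bracket (e i) v) = d i * coord k (bracket (e i) (diag d v))"
    proof cases
      case 1
      then show ?thesis unfolding coord_bracket_mid[OF n2 that k] using i by (simp add: coord_diag d0)
    next
      case 2
      then show ?thesis unfolding coord_bracket_mid[OF n2 that k] using i that by (simp add: coord_diag d_Suc d1 mult.assoc)
    next
      case 3
      have neg: "(i \<le> 2 * n - 2 \<and> 2 * n = i + 1) = False" "(2 * n = i) = False" using i by auto
      have dd: "d (2 * n) = d i * d (2 * n + 1 - i)" using d2n d_opp[OF that] by simp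
      show ?thesis unfolding coord_bracket_mid[OF n2 that k]
        unfolding 3 neg dd coord_diag[OF i(3)] by simp
    next
      case 4
      then show ?thesis unfolding coord_bracket_mid[OF n2 that k] by auto
    qed
    then show "coord k (diag d (bracket (e i) v)) = coord k (bracket (diag d (e i)) (diag d v))"
      using that k by (simp add: coord_diag diag_e bilinear_simps coord_scale)
  qed
  have last: "diag d (bracket (e (2 * n)) v) = bracket (diag d (e (2 * n))) (diag d v)" for v
    using n2 by (simp add: bracket_last diag_scale diag_e bilinear_simps coord_diag d0)
  have upper: "diag d (bracket (e i) v) = bracket (diag d (e i)) (diag d v)"
    if "2 \<le> i" "i \<le> 2 * n" for i v
    using that mid[of i v] last[of v] by (cases "i = 2 * n") auto
  have diag_minus: "diag d (- v) = - diag d v" for v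
    using diag_scale[of d "-1" v] by simp
  have upper': "diag d (bracket v (e i)) = bracket (diag d v) (diag d (e i))"
    if "2 \<le> i" "i \<le> 2 * n" for i v
    using upper[OF that, of v] bracket_antisym[of v "e i"] bracket_antisym[of "diag d v" "diag d (e i)"]
    by (simp add: diag_minus)
  have e1_x: "diag d (bracket (e 1) x) = bracket (diag d (e 1)) (diag d x)"
    using n2 by (simp add: bracket_e1_x diag_add diag_scale diag_e diag_x bilinear_simps d0 d1 d2n
        scale_right_distrib mult.commute[of a \<epsilon>])
  then have x_e1: "diag d (bracket x (e 1)) = bracket (diag d x) (diag d (e 1))"
    using bracket_antisym[of x "e 1"] bracket_antisym[of "diag d x" "diag d (e 1)"]
    by (simp add: diag_minus)
  have zero: "diag d 0 = 0" using diag_minus[of 0] diag_scale[of d 0 0] by simp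
  \<comment> \<open>Antisymmetry reduces brackets with \<open>e i\<close>, \<open>i \<ge> 2\<close>,
    to \<open>upper\<close>, so \<open>[e 1, x]\<close> is the only new case.\<close>
  have low: "diag d (bracket w v) = bracket (diag d w) (diag d v)" if "w = x \<or> w = e 1" for w v
  proof (induction v rule: basis_induct)
    case x
    then show ?case using that e1_x by (auto simp: bracket_self zero)
  next
    case (e i)
    then show ?case using that x_e1 upper'[of i w] by (cases "i = 1") (auto simp: bracket_self zero)
  next
    case (add u v)
    then show ?case by (simp add: bilinear_simps diag_add)
  next
    case (scale a u)
    then show ?case by (simp add: bilinear_simps diag_scale)
  qed
  show ?thesis
  proof (induction u rule: basis_induct)
    case x
    show ?case by (rule low) simp
  next
    case (e i)
    then show ?case using low[of "e 1" v] upper[of i v] by (cases "i = 1") auto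
  next
    case (add u v)
    then show ?case by (simp add: bilinear_simps diag_add)
  next
    case (scale a u)
    then show ?case by (simp add: bilinear_simps diag_scale)
  qed
qed

section \<open>The inner automorphism generated by \<open>e 2\<close>\<close>

definition shear :: "complex \<Rightarrow> 'a \<Rightarrow> 'a"
  where "shear s v = v + scale s (bracket (e 2) v)"

lemma bracket_e2:
  "3 \<le> n \<Longrightarrow> bracket (e 2) v = scale ((2 - of_nat n) * coord 0 v) (e 2) + scale (coord 1 v) (e 3)
    + scale (coord (2 * n - 1) v) (e (2 * n))"
  by (subst bracket_mid) (auto simp: One_nat_def)

text \<open>\<open>ad e 2\<close> maps into the span of \<open>e 2\<close>, \<open>e 3\<close>,
  \<open>e (2 * n)\<close>, which it kills. Hence its exponential stops at the linear term.\<close>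

lemma bracket_e2_bracket_e2:
  assumes "3 \<le> n"
  shows "bracket (e 2) (bracket (e 2) v) = 0"
proof -
  have "2 * n - 1 \<noteq> 2" "2 * n - 1 \<noteq> 3" "2 * n - 1 \<noteq> 2 * n" using assms by linarith+
  then show ?thesis using assms by (simp add: bracket_e2 coord_simps)
qed

text \<open>No two indices among \<open>2\<close>, \<open>3\<close>, \<open>2 * n\<close> add up to
  \<open>2 * n + 1\<close>. This removes the term quadratic in \<open>s\<close> from
  \<open>shear_bracket\<close>.\<close>

lemma bracket_e2_image_abelian:
  assumes "3 \<le> n"
  shows "bracket (bracket (e 2) u) (bracket (e 2) v) = 0"
proof -
  have "i + j \<noteq> 2 * n + 1" if "i \<in> {2, 3, 2 * n}" "j \<in> {2, 3, 2 * n}" for i j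
    using assms that by auto presburger
  then have "bracket (e i) (e j) = 0" if "i \<in> {2, 3, 2 * n}" "j \<in> {2, 3, 2 * n}" for i j
    using assms that by (intro bracket_e_e_zero') auto
  then show ?thesis using assms by (simp add: bracket_e2 bilinear_simps)
qed

text \<open>By the Jacobi identity \<open>ad e 2\<close> is a derivation, which matches the terms
  linear in \<open>s\<close>.\<close>

lemma shear_bracket:
  assumes "3 \<le> n"
  shows "shear s (bracket u v) = bracket (shear s u) (shear s v)"
proof -
  have "bracket u (bracket v (e 2)) = - bracket u (bracket (e 2) v)"
    using scale_right_arg[of u "-1" "bracket (e 2) v"] bracket_antisym[of v "e 2"] by simp
  moreover have "bracket v (bracket (e 2) u) = - bracket (bracket (e 2) u) v"
    by (rule bracket_antisym)
  ultimately have "bracket (e 2) (bracket u v) = bracket (bracket (e 2) u) v + bracket u (bracket (e 2) v)"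
    using jacobi[of "e 2" u v] by (simp add: diff_eq_eq)
  then show ?thesis
    by (simp add: shear_def bilinear_simps bracket_e2_image_abelian[OF assms] scale_right_distrib)
qed

lemma shear_inverse: "3 \<le> n \<Longrightarrow> shear (- s) (shear s v) = v"
  by (simp add: shear_def bilinear_simps bracket_e2_bracket_e2)

section \<open>Change of parameters under automorphisms\<close>

text \<open>Here \<open>a\<close> and \<open>t\<close> are the eigenvalues on \<open>e 1\<close> and
  \<open>e 2\<close>, and \<open>s\<close> is the shear parameter. The rule for
  \<open>\<beta>\<close> compares the images of \<open>e 2 \<cdot> x\<close>, the rule for
  \<open>\<gamma>\<close> those of \<open>x \<cdot> x\<close>.\<close>

lemma normal_mult_isomorphic:
  assumes n3: "3 \<le> n" and tp: "transposed_poisson_algebra scale bracket mult"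
    and mult: "\<And>u v. mult u v = normal_mult \<beta> \<gamma> u v"
    and a: "a \<noteq> 0" and t: "t ^ 2 * a ^ (2 * n - 4) = 1"
    and \<beta>: "\<beta> * a = t * \<beta>'" and \<gamma>: "\<gamma>' + s * t * \<beta>' = \<gamma> * a"
  shows "\<exists>\<phi>. transposed_poisson_isomorphism scale bracket mult scale bracket (normal_mult \<beta>' \<gamma>') \<phi>"
proof -
  interpret tp: transposed_poisson_algebra scale bracket mult by (rule tp)
  \<comment> \<open>Reaching \<open>e k\<close> from \<open>e 2\<close> takes \<open>k - 2\<close>
    brackets with \<open>e 1\<close>, hence the exponent.\<close>
  define d where "d k = (if k = 0 then 1 else if k = 1 \<or> k = 2 * n then a else t * a ^ (k - 2))" for k
  have t0: "t \<noteq> 0" using t by auto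
  have d_nz: "d k \<noteq> 0" for k using a t0 by (simp add: d_def)
  define \<phi> where "\<phi> v = diag d (shear s v)" for v
  have \<phi>_bracket: "\<phi> (bracket u v) = bracket (\<phi> u) (\<phi> v)" for u v
    unfolding \<phi>_def shear_bracket[OF n3]
  proof (rule diag_bracket)
    fix i assume i: "2 \<le> i" "i \<le> 2 * n - 2"
    then have "i + 1 - 2 = Suc (i - 2)" "i \<noteq> 2 * n" "i + 1 \<noteq> 2 * n" using n3 by linarith+
    then show "d (i + 1) = d i * a" using i by (simp add: d_def)
  next
    fix i assume i: "2 \<le> i" "i \<le> 2 * n - 1"
    have "d i * d (2 * n + 1 - i) = t ^ 2 * a ^ ((i - 2) + (2 * n + 1 - i - 2))"
      using i n3 unfolding power_add by (auto simp: d_def power2_eq_square)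
    also have "(i - 2) + (2 * n + 1 - i - 2) = Suc (2 * n - 4)" using i n3 by linarith
    finally show "d i * d (2 * n + 1 - i) = a" using t by (simp add: mult.left_commute)
  qed (use n3 in \<open>auto simp: d_def\<close>)
  have bij: "bij \<phi>"
  proof (rule o_bij)
    show "(\<lambda>v. shear (- s) (diag (\<lambda>k. 1 / d k) v)) \<circ> \<phi> = id"
      using d_nz shear_inverse[OF n3, of s] by (auto simp: \<phi>_def diag_inverse)
    show "\<phi> \<circ> (\<lambda>v. shear (- s) (diag (\<lambda>k. 1 / d k) v)) = id"
      using d_nz shear_inverse[OF n3, of "- s"] by (auto simp: \<phi>_def diag_inverse)
  qed
  have coord_\<phi>: "coord k (\<phi> v) = d k * (coord k v + s * coord k (bracket (e 2) v))" if "k \<le> 2 * n" for k v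
    using that by (simp add: \<phi>_def shear_def coord_diag coord_add coord_scale)
  have \<phi>_0: "coord 0 (\<phi> v) = coord 0 v" for v
    using n3 by (simp add: coord_\<phi> bracket_e2 coord_simps d_def)
  have \<phi>_2: "coord 2 (\<phi> v) = t * (coord 2 v + s * (2 - of_nat n) * coord 0 v)" for v
    using n3 by (simp add: coord_\<phi> bracket_e2 coord_simps d_def)
  have \<phi>_mult: "\<phi> (normal_mult \<beta> \<gamma> u v) = normal_mult \<beta>' \<gamma>' (\<phi> u) (\<phi> v)" for u v
  proof (rule coord_eqI)
    fix k assume k: "k \<le> 2 * n"
    define U W where "U = coord 0 u * coord 0 v" and "W = coord 0 u * coord 2 v + coord 2 u * coord 0 v"
    have idx: "2 * n - 1 \<noteq> 2 * n" "2 * n - 1 \<noteq> 2" "2 * n - 1 \<noteq> 1" "2 * n - 1 \<noteq> 0" using n3 by linarith+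
    have br: "bracket (e 2) (normal_mult \<beta> \<gamma> u v) = scale ((3 - 2 * of_nat n) * \<beta> * U) (e (2 * n))"
      using n3 idx by (simp add: bracket_e2 normal_mult_def coord_simps U_def)
    have W': "coord 0 (\<phi> u) * coord 2 (\<phi> v) + coord 2 (\<phi> u) * coord 0 (\<phi> v) = t * (W + 2 * s * (2 - of_nat n) * U)"
      by (simp add: \<phi>_0 \<phi>_2 U_def W_def algebra_simps)
    have L: "coord k (\<phi> (normal_mult \<beta> \<gamma> u v)) = d k * ((if k = 2 * n - 1 then (3 - 2 * of_nat n) * \<beta> * U else 0)
       + (if k = 2 * n then \<gamma> * U + \<beta> * W + s * ((3 - 2 * of_nat n) * \<beta> * U) else 0))"
      unfolding coord_\<phi>[OF k] br using n3 k by (auto simp: normal_mult_def coord_simps U_def W_def)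
    have R: "coord k (normal_mult \<beta>' \<gamma>' (\<phi> u) (\<phi> v)) = (if k = 2 * n - 1 then (3 - 2 * of_nat n) * \<beta>' * U else 0)
       + (if k = 2 * n then \<gamma>' * U + \<beta>' * (t * (W + 2 * s * (2 - of_nat n) * U)) else 0)"
      unfolding normal_mult_def W' using n3 k by (auto simp: coord_simps \<phi>_0 U_def)
    have "2 * n - 1 - 2 = Suc (2 * n - 4)" using n3 by linarith
    then have "d (2 * n - 1) * \<beta> = t * a ^ (2 * n - 4) * (\<beta> * a)"
      using n3 idx by (simp add: d_def)
    also have "\<dots> = \<beta>'" unfolding \<beta> using t by (simp add: power2_eq_square mult_ac)
    finally have d1: "d (2 * n - 1) * \<beta> = \<beta>'" .
    \<comment> \<open>The shear contributes \<open>3 - 2n\<close> through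
      \<open>[e 2, e (2 * n - 1)] = e (2 * n)\<close> on the left and \<open>2(2 - n)\<close>
      through \<open>[e 2, x]\<close> on the right. The difference \<open>1\<close> is the
      coefficient of \<open>s * t * \<beta>'\<close> in the hypothesis on
      \<open>\<gamma>\<close>.\<close>
    have d2: "a * (\<gamma> * U + \<beta> * W + s * ((3 - 2 * of_nat n) * \<beta> * U))
      = \<gamma>' * U + \<beta>' * (t * (W + 2 * s * (2 - of_nat n) * U))"
    proof -
      have "a * (\<gamma> * U + \<beta> * W + s * ((3 - 2 * of_nat n) * \<beta> * U))
        = (\<gamma> * a) * U + (\<beta> * a) * W + s * (3 - 2 * of_nat n) * (\<beta> * a) * U"
        by (simp add: algebra_simps)
      also have "\<dots> = \<gamma>' * U + \<beta>' * (t * (W + 2 * s * (2 - of_nat n) * U))"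
        unfolding \<beta> \<gamma>[symmetric] by (simp add: algebra_simps)
      finally show ?thesis .
    qed
    show "coord k (\<phi> (normal_mult \<beta> \<gamma> u v)) = coord k (normal_mult \<beta>' \<gamma>' (\<phi> u) (\<phi> v))"
    proof (cases "k = 2 * n")
      case True
      then show ?thesis unfolding L R using n3 d2 by (auto simp: d_def)
    next
      case False
      then show ?thesis unfolding L R by (simp add: d1[symmetric])
    qed
  qed
  have "transposed_poisson_isomorphism scale bracket mult scale bracket (normal_mult \<beta>' \<gamma>') \<phi>"
  proof (rule tp.isomorphism_transport)
    show "\<phi> (u + v) = \<phi> u + \<phi> v" for u v
      by (simp add: \<phi>_def shear_def diag_add bilinear_simps scale_right_distrib)
    show "\<phi> (scale r u) = scale r (\<phi> u)" for r u
      by (simp add: \<phi>_def shear_def diag_add diag_scale bilinear_simps scale_right_distrib mult.commute)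
    show "\<phi> (mult u v) = normal_mult \<beta>' \<gamma>' (\<phi> u) (\<phi> v)" for u v
      by (simp add: mult \<phi>_mult)
  qed (use bij \<phi>_bracket in auto)
  then show ?thesis by blast
qed

lemma TP1_normal_mult: "3 \<le> n \<Longrightarrow> TP1 n e x (normal_mult 0 1)"
  by (auto simp: TP1_def normal_mult_def coord_simps)

lemma TP2_normal_mult: "3 \<le> n \<Longrightarrow> TP2 scale n e x (normal_mult 1 0)"
  by (auto simp: TP2_def normal_mult_def coord_simps)

end

end

section \<open>Reduction to the two tables\<close>

theorem theorem3p9:
  fixes scale :: "complex \<Rightarrow> 'a::ab_group_add \<Rightarrow> 'a"
    and bracket mult :: "'a \<Rightarrow> 'a \<Rightarrow> 'a"
    and n :: nat and \<epsilon> :: complex and e :: "nat \<Rightarrow> 'a" and x :: 'a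
  assumes "n \<ge> 3"
    and "\<epsilon> \<in> {-1, 1}"
    and "lie_algebra_r scale bracket n \<epsilon> e x"
    and "transposed_poisson_algebra scale bracket mult"
    and "\<not> (\<forall>u v. mult u v = 0)"
  shows "\<exists>mult' \<phi>. transposed_poisson_isomorphism scale bracket mult scale bracket mult' \<phi> \<and>
           (TP1 n e x mult' \<or> TP2 scale n e x mult')"
proof -
  interpret lie_algebra_r scale bracket n \<epsilon> e x by (rule assms(3))
  note n3 = assms(1) and tp = assms(4)
  obtain \<beta> \<gamma> where mult: "\<And>u v. mult u v = normal_mult \<beta> \<gamma> u v"
    using transposed_poisson_normal_form[OF n3 tp] by blast
  show ?thesis
  proof (cases "\<beta> = 0")
    case True
    then have \<gamma>: "\<gamma> \<noteq> 0" using assms(5) mult by (auto simp: normal_mult_def)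
    \<comment> \<open>Normalising \<open>\<gamma>\<close> to \<open>1\<close> forces
      \<open>a = 1 / \<gamma>\<close>; this \<open>t\<close> then solves the constraint on
      \<open>t\<close> and \<open>a\<close>.\<close>
    have "(\<gamma> ^ (n - 2)) ^ 2 * (1 / \<gamma>) ^ (2 * n - 4) = 1"
    proof -
      have "(n - 2) * 2 = 2 * n - 4" by simp
      then show ?thesis using \<gamma> by (simp only: power_mult[symmetric]) (simp add: power_one_over)
    qed
    then have "\<exists>\<phi>. transposed_poisson_isomorphism scale bracket mult scale bracket (normal_mult 0 1) \<phi>"
      using True \<gamma> by (intro normal_mult_isomorphic[OF n3 tp mult, where a = "1 / \<gamma>" and t = "\<gamma> ^ (n - 2)"
            and s = 0]) simp_all
    then show ?thesis using TP1_normal_mult[OF n3] by blast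
  next
    case False
    \<comment> \<open>Normalising \<open>\<beta>\<close> to \<open>1\<close> forces
      \<open>t = \<beta> * a\<close>, which turns the constraint into
      \<open>(\<beta> * a ^ (n - 1))^2 = 1\<close>; a complex root \<open>a\<close> exists. The
      choice \<open>s = \<gamma> / \<beta>\<close> then makes the new \<open>\<gamma>\<close>
      vanish.\<close>
    have "card {a. a ^ (n - 1) = 1 / \<beta>} = n - 1"
      using False n3 by (intro card_nth_roots) auto
    then have "{a. a ^ (n - 1) = 1 / \<beta>} \<noteq> {}" using n3 by (intro notI) simp
    then obtain a where a: "a ^ (n - 1) = 1 / \<beta>" by blast
    then have a0: "a \<noteq> 0" using False n3 by (auto simp: power_0_left split: if_splits)
    have "2 + (2 * n - 4) = (n - 1) * 2" using n3 by linarith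
    then have "(\<beta> * a) ^ 2 * a ^ (2 * n - 4) = (\<beta> * a ^ (n - 1)) ^ 2"
      by (simp only: power_mult_distrib mult.assoc power_add[symmetric] power_mult[symmetric])
    also have "\<dots> = 1" using a False by simp
    finally have "\<exists>\<phi>. transposed_poisson_isomorphism scale bracket mult scale bracket (normal_mult 1 0) \<phi>"
      using False a0 by (intro normal_mult_isomorphic[OF n3 tp mult, where a = a and t = "\<beta> * a"
            and s = "\<gamma> / \<beta>"]) simp_all
    then show ?thesis using TP2_normal_mult[OF n3] by blast
  qed
qed

end
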